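(* Let $G$ be a group and $S \subset G$ a finite subset. Then a countably infinite subset $A \subset G$ admits an $S$-midpointed well-order if and only if it admits an $S$-midpointed order of order type $\omega$.
   Context: A total order $<$ on a subset $A$ of a group $G$ is $S$-midpointed, for $S \subset G$, if for all $g \in A$ and $h \in S$ with $\{gh^{-1}, gh\} \subset A$ we have $g \leq \max(gh^{-1}, gh)$. *)

theory Defs
  imports "HOL-Algebra.Group" "HOL-Library.Countable_Set"
begin

(* Orders are given by their reflexive relation: (x, y) \<in> r means x \<le> y. *)

definition order_max :: "'a rel \<Rightarrow> 'a \<Rightarrow> 'a \<Rightarrow> 'a" where
  "order_max r x y = (if (x, y) \<in> r then y else x)"

definition midpointed_order ::
    "('a, 'b) monoid_scheme \<Rightarrow> 'a set \<Rightarrow> 'a set \<Rightarrow> 'a rel \<Rightarrow> bool" where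
  "midpointed_order G S A r \<longleftrightarrow>
     linear_order_on A r \<and>
     (\<forall>g\<in>A. \<forall>h\<in>S.
        {g \<otimes>\<^bsub>G\<^esub> inv\<^bsub>G\<^esub> h, g \<otimes>\<^bsub>G\<^esub> h} \<subseteq> A \<longrightarrow>
        (g, order_max r (g \<otimes>\<^bsub>G\<^esub> inv\<^bsub>G\<^esub> h) (g \<otimes>\<^bsub>G\<^esub> h)) \<in> r)"

definition order_type_omega :: "'a rel \<Rightarrow> bool" where
  "order_type_omega r \<longleftrightarrow> (r, natLeq) \<in> ordIso"

end

theory Submission
  imports Defs
begin

text \<open>
  Only the implication from a well-order to an order of type \<open>\<omega>\<close> has content.  Let \<open>r\<close> be an
  \<open>S\<close>-midpointed well-order, and draw an edge from \<open>g\<close> to \<open>x\<close> whenever \<open>x\<close> is one of the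
  elements \<open>g h\<close>, \<open>g h\<inverse>\<close> with \<open>h \<in> S\<close> and \<open>g\<close> lies strictly below \<open>x\<close> in \<open>r\<close>.  For
  \<open>r\<close> to be midpointed means that, whenever \<open>g\<close>, \<open>g h\<close> and \<open>g h\<inverse>\<close> lie in \<open>A\<close> and \<open>h \<in> S\<close> is
  not the identity, at least one edge leads from \<open>g\<close> to \<open>g h\<close> or \<open>g h\<inverse>\<close>; so every linear order of \<open>A\<close>
  that contains all the edges is again midpointed.

  Since \<open>S\<close> is finite, every element has only finitely many incoming edges; since edges go up in a
  well-order, there is no infinite backward path.  By Koenig's argument
  (\<open>finite_ancestors\<close>) every element has only finitely many ancestors.  A well-founded relation
  with this property on a countably infinite set extends to a linear order of type \<open>\<omega>\<close>
  (\<open>omega_extension\<close>): list the elements of the set, and let each element, when its turn comes,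
  enter together with those of its ancestors that have not entered before, sorted by \<open>r\<close>.
\<close>

text \<open>
  Koenig's lemma in the form of an induction: the ancestors of \<open>x\<close> are \<open>x\<close> itself and the
  ancestors of its finitely many immediate predecessors.
\<close>

lemma finite_ancestors:
  assumes "wf E" and fin: "\<And>x. finite {y. (y, x) \<in> E}"
  shows "finite {y. (y, x) \<in> E\<^sup>*}"
  using \<open>wf E\<close>
proof (induction x rule: wf_induct_rule)
  case (less x)
  have "{y. (y, x) \<in> E\<^sup>*} \<subseteq> insert x (\<Union>z\<in>{z. (z, x) \<in> E}. {y. (y, z) \<in> E\<^sup>*})"
    by (auto elim: rtranclE)
  then show ?case
    by (rule finite_subset) (use less fin in auto)
qed

text \<open>
  As \<open>A\<close> is infinite, \<open>r\<close> is at least as long as \<open>\<omega>\<close>.  If it were longer, \<open>\<omega>\<close> would be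
  isomorphic to a proper initial segment of \<open>r\<close>, and these are finite.
\<close>

lemma order_type_omegaI:
  assumes wo: "well_order_on A r" and "infinite A"
    and fin: "\<And>x. x \<in> A \<Longrightarrow> finite {y. (y, x) \<in> r}"
  shows "order_type_omega r"
proof -
  have field: "Field r = A" and W: "Well_order r"
    using well_order_on_Well_order[OF wo] by simp_all
  have "(natLeq, card_of A) \<in> ordLeq"
    using \<open>infinite A\<close> infinite_iff_natLeq_ordLeq by blast
  then have le: "(natLeq, r) \<in> ordLeq"
    using card_of_least[OF wo] by (rule ordLeq_transitive)
  have "(natLeq, r) \<notin> ordLess"
  proof
    assume "(natLeq, r) \<in> ordLess"
    then obtain a where a: "a \<in> Field r" "(natLeq, Restr r (underS r a)) \<in> ordIso"
      using ordLess_iff_ordIso_Restr[OF W natLeq_Well_order] by blast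
    have "finite (underS r a)"
      by (rule finite_subset[OF _ fin[of a]]) (use a field in \<open>auto simp: underS_def\<close>)
    then have "finite (Field (Restr r (underS r a)))"
      by (rule finite_subset[rotated]) (auto simp: Field_def)
    moreover obtain f where "bij_betw f (Field natLeq) (Field (Restr r (underS r a)))"
      using a(2) by (auto simp: ordIso_def BNF_Wellorder_Embedding.iso_def)
    ultimately show False
      by (auto simp: Field_natLeq dest: bij_betw_finite)
  qed
  with le show ?thesis
    unfolding order_type_omega_def
    using ordLeq_iff_ordLess_or_ordIso ordIso_symmetric by blast
qed

lemma well_order_on_rank_lex:
  fixes rank :: "'a \<Rightarrow> nat"
  assumes wo: "well_order_on A r"
  shows "well_order_on A {(x, y). x \<in> A \<and> y \<in> A \<and>
           (rank x < rank y \<or> rank x = rank y \<and> (x, y) \<in> r)}" (is "well_order_on A ?s")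
proof -
  have r: "refl_on A r" "trans r" "antisym r" "total_on A r" "wf (r - Id)" "r \<subseteq> A \<times> A"
    using wo by (auto simp: well_order_on_def linear_order_on_def partial_order_on_def
        preorder_on_def)
  have "refl_on A ?s"
    using r(1) by (auto simp: refl_on_def)
  moreover have "trans ?s"
    using r(2) by (auto simp: trans_def)
  moreover have "antisym ?s"
    using r(3) by (auto simp: antisym_def)
  moreover have "total_on A ?s"
    using r(4) by (auto simp: total_on_def)
  moreover have "wf (?s - Id)"
  proof (rule wf_subset)
    show "wf (inv_image (less_than <*lex*> (r - Id)) (\<lambda>x. (rank x, x)))"
      using r(5) by (intro wf_inv_image wf_lex_prod wf_less_than)
    show "?s - Id \<subseteq> inv_image (less_than <*lex*> (r - Id)) (\<lambda>x. (rank x, x))"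
      by (auto simp: inv_image_def)
  qed
  ultimately show ?thesis
    by (auto simp: well_order_on_def linear_order_on_def partial_order_on_def preorder_on_def)
qed

text \<open>
  Fix an enumeration of \<open>A\<close> and let the rank of \<open>x\<close> be the first index at which a descendant of
  \<open>x\<close> is listed.  An ancestor of \<open>x\<close> has rank at most that of \<open>x\<close>, and only finitely many elements
  have a given rank.  Ordering by rank, with ties broken by \<open>r\<close>, thus respects \<open>E\<close> and has finite
  initial segments.
\<close>

lemma omega_extension:
  assumes wo: "well_order_on A r" and "countable A" and "infinite A"
    and E: "E \<subseteq> r - Id" and fin: "\<And>x. finite {y. (y, x) \<in> E}"
  obtains s where "well_order_on A s" "order_type_omega s" "E \<subseteq> s"
proof -
  have "r \<subseteq> A \<times> A" and wf: "wf (r - Id)"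
    using wo by (auto simp: well_order_on_def linear_order_on_def partial_order_on_def
        preorder_on_def)
  then have EA: "E \<subseteq> A \<times> A"
    using E by blast
  have anc: "finite {y. (y, x) \<in> E\<^sup>*}" for x
    using wf_subset[OF wf E] fin by (rule finite_ancestors)
  define a where "a = from_nat_into A"
  define rank where "rank x = (LEAST n. (x, a n) \<in> E\<^sup>*)" for x
  have rank: "(x, a (rank x)) \<in> E\<^sup>*" if "x \<in> A" for x
  proof -
    obtain n where "a n = x"
      using from_nat_into_surj[OF \<open>countable A\<close> \<open>x \<in> A\<close>] unfolding a_def by (rule exE)
    then have "(x, a n) \<in> E\<^sup>*"
      by simp
    then show ?thesis
      unfolding rank_def by (rule LeastI)
  qed
  define s where "s = {(x, y). x \<in> A \<and> y \<in> A \<and>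
           (rank x < rank y \<or> rank x = rank y \<and> (x, y) \<in> r)}"
  have s: "well_order_on A s"
    unfolding s_def using wo by (rule well_order_on_rank_lex)
  have "finite {y. (y, x) \<in> s}" if "x \<in> A" for x
  proof (rule finite_subset)
    show "{y. (y, x) \<in> s} \<subseteq> (\<Union>n\<le>rank x. {y. (y, a n) \<in> E\<^sup>*})"
    proof
      fix y assume "y \<in> {y. (y, x) \<in> s}"
      then have "y \<in> A" "rank y \<le> rank x"
        by (auto simp: s_def)
      then show "y \<in> (\<Union>n\<le>rank x. {y. (y, a n) \<in> E\<^sup>*})"
        using rank[of y] by blast
    qed
    show "finite (\<Union>n\<le>rank x. {y. (y, a n) \<in> E\<^sup>*})"
      using anc by simp
  qed
  then have "order_type_omega s"
    using order_type_omegaI[OF s \<open>infinite A\<close>] by blast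
  moreover have "E \<subseteq> s"
  proof (rule subrelI)
    fix x y assume xy: "(x, y) \<in> E"
    with EA have "x \<in> A" "y \<in> A" by auto
    have "(x, a (rank y)) \<in> E\<^sup>*"
      using xy rank[OF \<open>y \<in> A\<close>] by (rule converse_rtrancl_into_rtrancl)
    then have "rank x \<le> rank y"
      unfolding rank_def[of x] by (rule Least_le)
    then show "(x, y) \<in> s"
      using xy E \<open>x \<in> A\<close> \<open>y \<in> A\<close> by (auto simp: s_def)
  qed
  ultimately show ?thesis
    using that s by blast
qed

lemma linear_order_le_order_max_iff:
  assumes "linear_order_on A r" "x \<in> A" "y \<in> A"
  shows "(g, order_max r x y) \<in> r \<longleftrightarrow> (g, x) \<in> r \<or> (g, y) \<in> r"
proof -
  have "refl_on A r" "trans r" "total_on A r"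
    using assms(1) by (auto simp: linear_order_on_def partial_order_on_def preorder_on_def)
  then have "(x, y) \<in> r \<or> (y, x) \<in> r"
    using assms(2,3) by (cases "x = y") (auto simp: refl_on_def total_on_def)
  then show ?thesis
    using \<open>trans r\<close> by (auto simp: order_max_def dest: transD)
qed

context group
begin

definition step_relation :: "'a set \<Rightarrow> 'a set \<Rightarrow> 'a rel" where
  "step_relation S A =
     {(g, x). g \<in> A \<and> x \<in> A \<and> (\<exists>h\<in>S. x = g \<otimes> inv h \<or> x = g \<otimes> h)}"

lemma finite_step_predecessors:
  assumes "S \<subseteq> carrier G" "finite S" "A \<subseteq> carrier G"
  shows "finite {g. (g, x) \<in> step_relation S A}"
proof (rule finite_subset)
  show "{g. (g, x) \<in> step_relation S A} \<subseteq> (\<lambda>h. x \<otimes> h) ` S \<union> (\<lambda>h. x \<otimes> inv h) ` S"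
  proof
    fix g assume "g \<in> {g. (g, x) \<in> step_relation S A}"
    then obtain h where h: "g \<in> A" "h \<in> S" "x = g \<otimes> inv h \<or> x = g \<otimes> h"
      by (auto simp: step_relation_def)
    then have "g \<in> carrier G" "h \<in> carrier G"
      using assms by auto
    then have "g = x \<otimes> h \<or> g = x \<otimes> inv h"
      using h(3) by (auto simp: m_assoc)
    then show "g \<in> (\<lambda>h. x \<otimes> h) ` S \<union> (\<lambda>h. x \<otimes> inv h) ` S"
      using h(2) by blast
  qed
qed (use assms in simp)

text \<open>
  Being midpointed only asks for a comparison \<open>g \<le> g h\<inverse>\<close> or \<open>g \<le> g h\<close>, so it passes to every
  linear order that keeps the upward steps.
\<close>

lemma midpointed_order_mono_steps:
  assumes mid: "midpointed_order G S A r" and s: "linear_order_on A s"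
    and sub: "r \<inter> step_relation S A \<subseteq> s"
  shows "midpointed_order G S A s"
  unfolding midpointed_order_def
proof (intro conjI ballI impI s)
  fix g h
  assume gh: "g \<in> A" "h \<in> S" "{g \<otimes> inv h, g \<otimes> h} \<subseteq> A"
  have r: "linear_order_on A r"
    and max: "(g, order_max r (g \<otimes> inv h) (g \<otimes> h)) \<in> r"
    using mid gh by (auto simp: midpointed_order_def)
  have "(g, g \<otimes> inv h) \<in> r \<or> (g, g \<otimes> h) \<in> r"
    using max linear_order_le_order_max_iff[OF r] gh(3) by simp
  moreover have "(g, g \<otimes> inv h) \<in> step_relation S A" "(g, g \<otimes> h) \<in> step_relation S A"
    using gh by (auto simp: step_relation_def)
  ultimately have "(g, g \<otimes> inv h) \<in> s \<or> (g, g \<otimes> h) \<in> s"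
    using sub by blast
  then show "(g, order_max s (g \<otimes> inv h) (g \<otimes> h)) \<in> s"
    using linear_order_le_order_max_iff[OF s] gh(3) by simp
qed

end

theorem lemma64:
  fixes G (structure) and S A :: "'a set"
  assumes "group G"
    and "S \<subseteq> carrier G" and "finite S"
    and "A \<subseteq> carrier G" and "countable A" and "infinite A"
  shows "(\<exists>r. midpointed_order G S A r \<and> well_order_on A r) \<longleftrightarrow>
         (\<exists>r. midpointed_order G S A r \<and> order_type_omega r)"
proof
  interpret group G by fact
  assume "\<exists>r. midpointed_order G S A r \<and> well_order_on A r"
  then obtain r where mid: "midpointed_order G S A r" and wo: "well_order_on A r"
    by blast
  \<comment> \<open>If the identity lies in \<open>S\<close>, steps include loops, which would spoil well-foundedness.\<close>
  define E where "E = r \<inter> step_relation S A - Id"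
  have "E \<subseteq> r - Id"
    by (auto simp: E_def)
  moreover have "finite {y. (y, x) \<in> E}" for x
    by (rule finite_subset[OF _ finite_step_predecessors[OF assms(2,3,4), of x]])
      (auto simp: E_def)
  ultimately obtain s where s: "well_order_on A s" "order_type_omega s" "E \<subseteq> s"
    using omega_extension[OF wo assms(5,6)] by blast
  then have lin: "linear_order_on A s"
    by (simp add: well_order_on_def)
  then have "refl_on A s"
    by (simp add: linear_order_on_def partial_order_on_def preorder_on_def)
  then have "Id_on A \<subseteq> s"
    by (auto simp: refl_on_def)
  moreover have "r \<inter> step_relation S A \<subseteq> E \<union> Id_on A"
    by (auto simp: E_def step_relation_def)
  ultimately have "r \<inter> step_relation S A \<subseteq> s"
    using s(3) by blast
  then have "midpointed_order G S A s"
    by (rule midpointed_order_mono_steps[OF mid lin])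
  then show "\<exists>r. midpointed_order G S A r \<and> order_type_omega r"
    using s(2) by blast
next
  assume "\<exists>r. midpointed_order G S A r \<and> order_type_omega r"
  then obtain r where mid: "midpointed_order G S A r" and "order_type_omega r"
    by blast
  then have "Well_order r"
    by (auto simp: order_type_omega_def ordIso_def)
  then have "wf (r - Id)"
    by (simp add: well_order_on_def)
  moreover have "linear_order_on A r"
    using mid by (simp add: midpointed_order_def)
  ultimately have "well_order_on A r"
    by (simp add: well_order_on_def)
  then show "\<exists>r. midpointed_order G S A r \<and> well_order_on A r"
    using mid by blast
qed

end
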